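(* Let $G$ be a finitely generated infinite group having a nilpotent subgroup of finite index. Then $\mathrm{FC}(G)$ is infinite, and hence $\ker\left(G \curvearrowright \mathrm{Cone}_{\omega}(G,d_n)\right)$ is also infinite, for every non-principal ultrafilter $\omega$ on $\mathbb{N}$ and every unbounded non-decreasing sequence $(d_n)$ of positive reals.
   Context: Let $S$ be a finite generating set of $G$ with word length $\|\cdot\|_S$. $\mathrm{Cone}_\omega(G,d_n)$ is the ultralimit of $(\Gamma(G,S), \frac{1}{d_n}d_S, e)$; its points are represented by sequences $\{x_n\}$ in $G$ with $\|x_n\|_S/d_n$ bounded (admissible sequences), where $\{x_n\}=\{y_n\}$ iff $\lim_\omega \|x_n^{-1}y_n\|_S/d_n=0$. $G$ acts isometrically by $g\cdot\{x_n\}=\{gx_n\}$. The kernel is the set of $g \in G$ with $\lim_\omega \|x_n^{-1}gx_n\|_S/d_n=0$ for all admissible $\{x_n\}$. $\mathrm{FC}(G)=\{g\in G: |\{x^{-1}gx: x\in G\}|<\infty\}$. *)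

theory Defs
  imports Complex_Main "HOL-Algebra.Generated_Groups" "HOL-Algebra.Group_Action"
begin

section \<open>Group-theoretic notions\<close>

fun lower_central :: "('a, 'b) monoid_scheme \<Rightarrow> nat \<Rightarrow> 'a set" where
  "lower_central G 0 = carrier G"
| "lower_central G (Suc k) =
     generate G {x \<otimes>\<^bsub>G\<^esub> y \<otimes>\<^bsub>G\<^esub> inv\<^bsub>G\<^esub> x \<otimes>\<^bsub>G\<^esub> inv\<^bsub>G\<^esub> y | x y. x \<in> lower_central G k \<and> y \<in> carrier G}"

definition nilpotent_group :: "('a, 'b) monoid_scheme \<Rightarrow> bool" where
  "nilpotent_group G \<longleftrightarrow> group G \<and> (\<exists>c. lower_central G c = {\<one>\<^bsub>G\<^esub>})"

definition finite_index :: "('a, 'b) monoid_scheme \<Rightarrow> 'a set \<Rightarrow> bool" where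
  "finite_index G H \<longleftrightarrow> subgroup H G \<and> finite (rcosets\<^bsub>G\<^esub> H)"

definition finite_generating_set :: "('a, 'b) monoid_scheme \<Rightarrow> 'a set \<Rightarrow> bool" where
  "finite_generating_set G S \<longleftrightarrow> finite S \<and> S \<subseteq> carrier G \<and> generate G S = carrier G"

definition FC :: "('a, 'b) monoid_scheme \<Rightarrow> 'a set" where
  "FC G = {g \<in> carrier G. finite {inv\<^bsub>G\<^esub> x \<otimes>\<^bsub>G\<^esub> g \<otimes>\<^bsub>G\<^esub> x | x. x \<in> carrier G}}"

text \<open>Words are lists of letters from the generators and their inverses. The value is only
  meaningful for elements of the subgroup generated by \<open>S\<close>.\<close>

definition word_length :: "('a, 'b) monoid_scheme \<Rightarrow> 'a set \<Rightarrow> 'a \<Rightarrow> nat" where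
  "word_length G S g =
     (LEAST n. \<exists>ws. length ws = n \<and> set ws \<subseteq> S \<union> m_inv G ` S \<and> foldr (\<otimes>\<^bsub>G\<^esub>) ws \<one>\<^bsub>G\<^esub> = g)"

section \<open>Ultrafilters\<close>

text \<open>Ultrafilters are represented as filters in the sense of \<^typ>\<open>'a filter\<close>, so that the
  limit along an ultrafilter is the library's \<open>tendsto\<close>. A set \<open>A\<close> belongs to \<open>\<omega>\<close> iff
  \<open>\<forall>\<^sub>F n in \<omega>. n \<in> A\<close>.\<close>

definition ultrafilter :: "'a filter \<Rightarrow> bool" where
  "ultrafilter \<omega> \<longleftrightarrow>
     \<omega> \<noteq> bot \<and> (\<forall>P. eventually P \<omega> \<or> eventually (\<lambda>n. \<not> P n) \<omega>)"

definition nonprincipal_ultrafilter :: "'a filter \<Rightarrow> bool" where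
  "nonprincipal_ultrafilter \<omega> \<longleftrightarrow> ultrafilter \<omega> \<and> (\<forall>n. \<omega> \<noteq> principal {n})"

section \<open>Asymptotic cones\<close>

definition admissible ::
    "('a, 'b) monoid_scheme \<Rightarrow> 'a set \<Rightarrow> (nat \<Rightarrow> real) \<Rightarrow> (nat \<Rightarrow> 'a) set" where
  "admissible G S d =
     {x. (\<forall>n. x n \<in> carrier G) \<and> Bseq (\<lambda>n. real (word_length G S (x n)) / d n)}"

definition cone_rel ::
    "('a, 'b) monoid_scheme \<Rightarrow> 'a set \<Rightarrow> nat filter \<Rightarrow> (nat \<Rightarrow> real) \<Rightarrow> (nat \<Rightarrow> 'a) rel" where
  "cone_rel G S \<omega> d =
     {(x, y). x \<in> admissible G S d \<and> y \<in> admissible G S d \<and>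
        ((\<lambda>n. real (word_length G S (inv\<^bsub>G\<^esub> (x n) \<otimes>\<^bsub>G\<^esub> y n)) / d n) \<longlongrightarrow> 0) \<omega>}"

text \<open>The set of points of the cone. Every point of the rescaled Cayley graph is within
  \<open>1 / (2 * d n)\<close> of a vertex, so (as \<open>d\<close> tends to infinity) sequences of group elements
  suffice to represent all points of the ultralimit.\<close>

definition Cone ::
    "('a, 'b) monoid_scheme \<Rightarrow> 'a set \<Rightarrow> nat filter \<Rightarrow> (nat \<Rightarrow> real) \<Rightarrow> (nat \<Rightarrow> 'a) set set" where
  "Cone G S \<omega> d = admissible G S d // cone_rel G S \<omega> d"

definition cone_action ::
    "('a, 'b) monoid_scheme \<Rightarrow> 'a set \<Rightarrow> nat filter \<Rightarrow> (nat \<Rightarrow> real) \<Rightarrow>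
       'a \<Rightarrow> (nat \<Rightarrow> 'a) set \<Rightarrow> (nat \<Rightarrow> 'a) set" where
  "cone_action G S \<omega> d g =
     (\<lambda>p \<in> Cone G S \<omega> d. \<Union>x\<in>p. cone_rel G S \<omega> d `` {\<lambda>n. g \<otimes>\<^bsub>G\<^esub> x n})"

definition cone_kernel ::
    "('a, 'b) monoid_scheme \<Rightarrow> 'a set \<Rightarrow> nat filter \<Rightarrow> (nat \<Rightarrow> real) \<Rightarrow> 'a set" where
  "cone_kernel G S \<omega> d = kernel G (BijGroup (Cone G S \<omega> d)) (cone_action G S \<omega> d)"

subsection \<open>The action is well defined, and the elementwise description of its kernel\<close>

context group
begin

lemma foldr_mult_closed:
  "set ws \<subseteq> carrier G \<Longrightarrow> foldr (\<otimes>) ws \<one> \<in> carrier G"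
  by (induction ws) auto

lemma foldr_mult_append:
  "set us \<subseteq> carrier G \<Longrightarrow> set vs \<subseteq> carrier G \<Longrightarrow>
     foldr (\<otimes>) (us @ vs) \<one> = foldr (\<otimes>) us \<one> \<otimes> foldr (\<otimes>) vs \<one>"
proof (induction us)
  case Nil
  then show ?case using foldr_mult_closed[of vs] by simp
next
  case (Cons u us)
  then show ?case using foldr_mult_closed[of vs] foldr_mult_closed[of us] by (simp add: m_assoc)
qed

lemma foldr_mult_inv:
  "set ws \<subseteq> carrier G \<Longrightarrow>
     foldr (\<otimes>) (rev (map (m_inv G) ws)) \<one> = inv (foldr (\<otimes>) ws \<one>)"
proof (induction ws)
  case Nil
  then show ?case by simp
next
  case (Cons w ws)
  have "set (rev (map (m_inv G) ws)) \<subseteq> carrier G" "set [inv w] \<subseteq> carrier G"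
    using Cons.prems by auto
  from foldr_mult_append[OF this] show ?case
    using Cons foldr_mult_closed[of ws] by (simp add: inv_mult_group)
qed

lemma letters_closed:
  assumes "S \<subseteq> carrier G"
  shows "S \<union> m_inv G ` S \<subseteq> carrier G"
  using assms by auto

lemma letters_inv:
  assumes "S \<subseteq> carrier G" "set ws \<subseteq> S \<union> m_inv G ` S"
  shows "set (rev (map (m_inv G) ws)) \<subseteq> S \<union> m_inv G ` S"
proof -
  have "inv w \<in> S \<union> m_inv G ` S" if "w \<in> S \<union> m_inv G ` S" for w
    using that assms(1) by auto
  then show ?thesis unfolding set_rev set_map using assms(2) by (intro image_subsetI) blast
qed

lemma word_exists:
  assumes S: "S \<subseteq> carrier G" and "g \<in> generate G S"
  shows "\<exists>ws. set ws \<subseteq> S \<union> m_inv G ` S \<and> foldr (\<otimes>) ws \<one> = g"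
  using assms(2)
proof (induction rule: generate.induct)
  case one
  show ?case by (rule exI[of _ "[]"]) simp
next
  case (incl h)
  then show ?case using S by (intro exI[of _ "[h]"]) auto
next
  case (inv h)
  then show ?case using S by (intro exI[of _ "[inv h]"]) auto
next
  case (eng h1 h2)
  then obtain us vs where
    "set us \<subseteq> S \<union> m_inv G ` S" "foldr (\<otimes>) us \<one> = h1"
    "set vs \<subseteq> S \<union> m_inv G ` S" "foldr (\<otimes>) vs \<one> = h2" by blast
  moreover from this have "foldr (\<otimes>) (us @ vs) \<one> = h1 \<otimes> h2"
    using foldr_mult_append[of us vs] letters_closed[OF S] by blast
  ultimately show ?case by (intro exI[of _ "us @ vs"]) auto
qed

lemma word_length_le:
  assumes "set ws \<subseteq> S \<union> m_inv G ` S"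
  shows "word_length G S (foldr (\<otimes>) ws \<one>) \<le> length ws"
  unfolding word_length_def by (rule Least_le) (use assms in blast)

lemma word_length_word:
  assumes "S \<subseteq> carrier G" "g \<in> generate G S"
  obtains ws where "set ws \<subseteq> S \<union> m_inv G ` S" "foldr (\<otimes>) ws \<one> = g"
    "length ws = word_length G S g"
proof -
  let ?P = "\<lambda>n. \<exists>ws. length ws = n \<and> set ws \<subseteq> S \<union> m_inv G ` S \<and> foldr (\<otimes>) ws \<one> = g"
  have "\<exists>n. ?P n" using word_exists[OF assms] by blast
  then have "?P (word_length G S g)" unfolding word_length_def by (rule LeastI_ex)
  then show ?thesis using that by blast
qed

lemma word_length_one: "word_length G S \<one> = 0"
  using word_length_le[of "[]" S] by simp

lemma word_length_mult:
  assumes "finite_generating_set G S" "g \<in> carrier G" "h \<in> carrier G"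
  shows "word_length G S (g \<otimes> h) \<le> word_length G S g + word_length G S h"
proof -
  have S: "S \<subseteq> carrier G" and gh: "g \<in> generate G S" "h \<in> generate G S"
    using assms by (auto simp: finite_generating_set_def)
  obtain us where us: "set us \<subseteq> S \<union> m_inv G ` S" "foldr (\<otimes>) us \<one> = g"
    "length us = word_length G S g" using word_length_word[OF S gh(1)] .
  obtain vs where vs: "set vs \<subseteq> S \<union> m_inv G ` S" "foldr (\<otimes>) vs \<one> = h"
    "length vs = word_length G S h" using word_length_word[OF S gh(2)] .
  have "foldr (\<otimes>) (us @ vs) \<one> = g \<otimes> h"
    using foldr_mult_append[of us vs] us vs letters_closed[OF S] by blast
  then show ?thesis using word_length_le[of "us @ vs" S] us vs by auto
qed

lemma word_length_inv:
  assumes "finite_generating_set G S" "g \<in> carrier G"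
  shows "word_length G S (inv g) = word_length G S g"
proof -
  have S: "S \<subseteq> carrier G" and gen: "generate G S = carrier G"
    using assms by (auto simp: finite_generating_set_def)
  have le: "word_length G S (inv h) \<le> word_length G S h" if h: "h \<in> carrier G" for h
  proof -
    obtain us where us: "set us \<subseteq> S \<union> m_inv G ` S" "foldr (\<otimes>) us \<one> = h"
      "length us = word_length G S h" using word_length_word[OF S, of h] gen h by blast
    show ?thesis
      using word_length_le[OF letters_inv[OF S us(1)]] us foldr_mult_inv[of us] letters_closed[OF S]
      by auto
  qed
  from le[of g] le[of "inv g"] assms(2) show ?thesis by simp
qed

end

locale cone_setup = group G for G (structure) +
  fixes S :: "'a set" and \<omega> :: "nat filter" and d :: "nat \<Rightarrow> real"
  assumes gen: "finite_generating_set G S"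
    and pos: "\<And>n. 0 < d n"
    and mono: "incseq d"
begin

lemma cone_relI:
  "x \<in> admissible G S d \<Longrightarrow> y \<in> admissible G S d \<Longrightarrow>
     ((\<lambda>n. real (word_length G S (inv (x n) \<otimes> y n)) / d n) \<longlongrightarrow> 0) \<omega> \<Longrightarrow>
     (x, y) \<in> cone_rel G S \<omega> d"
  by (simp add: cone_rel_def)

lemma admissible_closed: "x \<in> admissible G S d \<Longrightarrow> x n \<in> carrier G"
  by (simp add: admissible_def)

lemma equiv_cone_rel: "equiv (admissible G S d) (cone_rel G S \<omega> d)"
proof (rule equivI)
  show "cone_rel G S \<omega> d \<subseteq> admissible G S d \<times> admissible G S d"
    by (auto simp: cone_rel_def)
  show "refl_on (admissible G S d) (cone_rel G S \<omega> d)"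
    by (auto simp: refl_on_def cone_rel_def admissible_closed word_length_one)
  show "sym (cone_rel G S \<omega> d)"
  proof (rule symI)
    fix x y assume xy: "(x, y) \<in> cone_rel G S \<omega> d"
    then have adm: "x \<in> admissible G S d" "y \<in> admissible G S d" by (auto simp: cone_rel_def)
    have "word_length G S (inv (y n) \<otimes> x n) = word_length G S (inv (x n) \<otimes> y n)" for n
      using word_length_inv[OF gen, of "inv (x n) \<otimes> y n"] adm
      by (simp add: admissible_closed inv_mult_group)
    with xy adm show "(y, x) \<in> cone_rel G S \<omega> d" by (simp add: cone_rel_def)
  qed
  show "trans (cone_rel G S \<omega> d)"
  proof (rule transI)
    fix x y z assume xy: "(x, y) \<in> cone_rel G S \<omega> d" and yz: "(y, z) \<in> cone_rel G S \<omega> d"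
    then have adm: "x \<in> admissible G S d" "y \<in> admissible G S d" "z \<in> admissible G S d"
      by (auto simp: cone_rel_def)
    let ?D = "\<lambda>u v n. real (word_length G S (inv (u n) \<otimes> v n)) / d n"
    have le: "?D x z n \<le> ?D x y n + ?D y z n" for n
    proof -
      have c: "x n \<in> carrier G" "y n \<in> carrier G" "z n \<in> carrier G"
        using adm by (auto simp: admissible_closed)
      have "y n \<otimes> (inv (y n) \<otimes> z n) = z n"
        using c by (simp add: m_assoc[symmetric])
      then have "inv (x n) \<otimes> z n = (inv (x n) \<otimes> y n) \<otimes> (inv (y n) \<otimes> z n)"
        using c by (simp add: m_assoc)
      then have "word_length G S (inv (x n) \<otimes> z n) \<le>
          word_length G S (inv (x n) \<otimes> y n) + word_length G S (inv (y n) \<otimes> z n)"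
        using word_length_mult[OF gen, of "inv (x n) \<otimes> y n" "inv (y n) \<otimes> z n"] c by simp
      then have "real (word_length G S (inv (x n) \<otimes> z n)) \<le>
          real (word_length G S (inv (x n) \<otimes> y n)) + real (word_length G S (inv (y n) \<otimes> z n))"
        by linarith
      from divide_right_mono[OF this less_imp_le[OF pos[of n]]] show ?thesis
        by (simp only: add_divide_distrib)
    qed
    have "((\<lambda>n. ?D x y n + ?D y z n) \<longlongrightarrow> 0 + 0) \<omega>"
      using xy yz by (intro tendsto_add) (auto simp: cone_rel_def)
    then have lim: "((\<lambda>n. ?D x y n + ?D y z n) \<longlongrightarrow> 0) \<omega>" by simp
    have "0 \<le> ?D x z n" for n
      using pos[of n] by simp
    then have "(?D x z \<longlongrightarrow> 0) \<omega>"
      by (intro tendsto_sandwich[OF _ _ tendsto_const lim] always_eventually allI le)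
    then show "(x, z) \<in> cone_rel G S \<omega> d" using adm by (intro cone_relI)
  qed
qed

lemma admissible_translate:
  assumes g: "g \<in> carrier G" and x: "x \<in> admissible G S d"
  shows "(\<lambda>n. g \<otimes> x n) \<in> admissible G S d"
proof -
  obtain K where K: "\<And>n. norm (real (word_length G S (x n)) / d n) \<le> K"
    using x by (auto simp: admissible_def Bseq_def)
  have "norm (real (word_length G S (g \<otimes> x n)) / d n) \<le> real (word_length G S g) / d 0 + K" for n
  proof -
    have "real (word_length G S (g \<otimes> x n)) / d n \<le>
        (real (word_length G S g) + real (word_length G S (x n))) / d n"
      using word_length_mult[OF gen g, of "x n"] x pos[of n]
      by (intro divide_right_mono) (auto simp: admissible_closed)
    moreover have "real (word_length G S g) / d n \<le> real (word_length G S g) / d 0"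
      using pos[of 0] pos[of n] incseqD[OF mono, of 0 n] by (intro divide_left_mono) auto
    moreover have "real (word_length G S (x n)) / d n \<le> K" using K[of n] pos[of n] by simp
    ultimately show ?thesis using pos[of n] by (simp add: add_divide_distrib)
  qed
  then have "Bseq (\<lambda>n. real (word_length G S (g \<otimes> x n)) / d n)" by (rule BseqI')
  then show ?thesis using g x by (simp add: admissible_def)
qed

lemma translate_diff:
  assumes "g \<in> carrier G" "a \<in> carrier G" "b \<in> carrier G"
  shows "inv (g \<otimes> a) \<otimes> (g \<otimes> b) = inv a \<otimes> b"
proof -
  have "inv g \<otimes> (g \<otimes> b) = b"
    using assms by (simp add: m_assoc[symmetric])
  then show ?thesis using assms by (simp add: inv_mult_group m_assoc)
qed

lemma cone_action_class:
  assumes g: "g \<in> carrier G" and x: "x \<in> admissible G S d"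
  shows "cone_action G S \<omega> d g (cone_rel G S \<omega> d `` {x}) = cone_rel G S \<omega> d `` {\<lambda>n. g \<otimes> x n}"
proof -
  let ?R = "cone_rel G S \<omega> d"
  have "(\<lambda>x. ?R `` {\<lambda>n. g \<otimes> x n}) respects ?R"
  proof (rule congruentI)
    fix u v assume uv: "(u, v) \<in> ?R"
    then have adm: "u \<in> admissible G S d" "v \<in> admissible G S d" by (auto simp: cone_rel_def)
    have "((\<lambda>n. g \<otimes> u n), (\<lambda>n. g \<otimes> v n)) \<in> ?R"
      using uv adm g by (auto simp: cone_rel_def admissible_translate translate_diff admissible_closed)
    then show "?R `` {\<lambda>n. g \<otimes> u n} = ?R `` {\<lambda>n. g \<otimes> v n}"
      by (rule equiv_class_eq[OF equiv_cone_rel])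
  qed
  from UN_equiv_class[OF equiv_cone_rel this x] show ?thesis
    using x by (simp add: cone_action_def Cone_def quotientI)
qed

lemma cone_action_closed:
  assumes "g \<in> carrier G" "p \<in> Cone G S \<omega> d"
  shows "cone_action G S \<omega> d g p \<in> Cone G S \<omega> d"
  using assms unfolding Cone_def
  by (auto elim!: quotientE simp: cone_action_class intro!: quotientI admissible_translate)

lemma cone_action_mult:
  assumes "g \<in> carrier G" "h \<in> carrier G" "p \<in> Cone G S \<omega> d"
  shows "cone_action G S \<omega> d (g \<otimes> h) p = cone_action G S \<omega> d g (cone_action G S \<omega> d h p)"
  using assms unfolding Cone_def
  by (auto elim!: quotientE simp: cone_action_class admissible_translate m_assoc admissible_closed)

lemma cone_action_one:
  assumes "p \<in> Cone G S \<omega> d"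
  shows "cone_action G S \<omega> d \<one> p = p"
  using assms unfolding Cone_def
  by (auto elim!: quotientE simp: cone_action_class admissible_closed)

lemma cone_action_Bij:
  assumes g: "g \<in> carrier G"
  shows "cone_action G S \<omega> d g \<in> Bij (Cone G S \<omega> d)"
proof -
  have inverse: "cone_action G S \<omega> d (inv h) (cone_action G S \<omega> d h p) = p"
    if "h \<in> carrier G" "p \<in> Cone G S \<omega> d" for h p
    using that cone_action_mult[of "inv h" h p] cone_action_one by simp
  have "bij_betw (cone_action G S \<omega> d g) (Cone G S \<omega> d) (Cone G S \<omega> d)"
    by (rule bij_betw_byWitness[where f' = "cone_action G S \<omega> d (inv g)"])
      (use g inverse[of g] inverse[of "inv g"] in \<open>auto simp: cone_action_closed\<close>)
  then show ?thesis by (simp add: Bij_def cone_action_def)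
qed

theorem group_action_cone: "group_action G (Cone G S \<omega> d) (cone_action G S \<omega> d)"
proof -
  have "cone_action G S \<omega> d (g \<otimes> h) =
      compose (Cone G S \<omega> d) (cone_action G S \<omega> d g) (cone_action G S \<omega> d h)"
    if "g \<in> carrier G" "h \<in> carrier G" for g h
  proof (rule ext)
    fix p show "cone_action G S \<omega> d (g \<otimes> h) p =
      compose (Cone G S \<omega> d) (cone_action G S \<omega> d g) (cone_action G S \<omega> d h) p"
      using that by (cases "p \<in> Cone G S \<omega> d")
        (simp_all add: compose_def cone_action_mult, simp add: cone_action_def)
  qed
  then have "cone_action G S \<omega> d \<in> hom G (BijGroup (Cone G S \<omega> d))"
    by (auto simp: hom_def BijGroup_def cone_action_Bij)
  then show ?thesis
    unfolding group_action_def group_hom_def group_hom_axioms_def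
    using group_axioms group_BijGroup by blast
qed

theorem cone_kernel_eq:
  "cone_kernel G S \<omega> d =
     {g \<in> carrier G. \<forall>x \<in> admissible G S d.
        ((\<lambda>n. real (word_length G S (inv (x n) \<otimes> g \<otimes> x n)) / d n) \<longlongrightarrow> 0) \<omega>}"
proof -
  let ?R = "cone_rel G S \<omega> d"
  have fixed: "cone_action G S \<omega> d g (?R `` {x}) = ?R `` {x} \<longleftrightarrow>
      ((\<lambda>n. real (word_length G S (inv (x n) \<otimes> g \<otimes> x n)) / d n) \<longlongrightarrow> 0) \<omega>"
    if g: "g \<in> carrier G" and x: "x \<in> admissible G S d" for g x
  proof -
    have "cone_action G S \<omega> d g (?R `` {x}) = ?R `` {x} \<longleftrightarrow> ?R `` {x} = ?R `` {\<lambda>n. g \<otimes> x n}"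
      using cone_action_class[OF g x] by auto
    also have "\<dots> \<longleftrightarrow> (x, \<lambda>n. g \<otimes> x n) \<in> ?R"
      using eq_equiv_class_iff[OF equiv_cone_rel x admissible_translate[OF g x]] .
    also have "\<dots> \<longleftrightarrow>
        ((\<lambda>n. real (word_length G S (inv (x n) \<otimes> g \<otimes> x n)) / d n) \<longlongrightarrow> 0) \<omega>"
      using g x by (simp add: cone_rel_def admissible_translate m_assoc admissible_closed)
    finally show ?thesis .
  qed
  have triv: "cone_action G S \<omega> d g = \<one>\<^bsub>BijGroup (Cone G S \<omega> d)\<^esub> \<longleftrightarrow>
      (\<forall>x \<in> admissible G S d. cone_action G S \<omega> d g (?R `` {x}) = ?R `` {x})" for g
  proof -
    have "cone_action G S \<omega> d g = \<one>\<^bsub>BijGroup (Cone G S \<omega> d)\<^esub> \<longleftrightarrow>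
        (\<forall>p \<in> Cone G S \<omega> d. cone_action G S \<omega> d g p = p)"
      by (auto simp: BijGroup_def cone_action_def fun_eq_iff restrict_def)
    also have "\<dots> \<longleftrightarrow>
        (\<forall>x \<in> admissible G S d. cone_action G S \<omega> d g (?R `` {x}) = ?R `` {x})"
      unfolding Cone_def by (metis quotientE quotientI)
    finally show ?thesis .
  qed
  show ?thesis
    unfolding cone_kernel_def kernel_def triv using fixed by auto
qed

end

end

(* If FC(G) is finite, then every element whose commutators with a finite index subgroup H all lie
   in FC(G) has finitely many H-conjugates, hence finitely many G-conjugates, and so belongs to
   FC(G) itself. Climbing the lower central series of a nilpotent H from its trivial term gives
   H <= FC(G), so H and G are finite.
   An element of FC(G) has only finitely many conjugates, whose word lengths are bounded, and
   dividing by d tending to infinity along omega shows that it acts trivially on the cone. *)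
theory Submission
  imports Defs
begin

context group
begin

lemma finite_index_transversal:
  assumes "finite_index G H"
  obtains T where "finite T" "T \<subseteq> carrier G"
    "\<And>x. x \<in> carrier G \<Longrightarrow> \<exists>h\<in>H. \<exists>t\<in>T. x = h \<otimes> t"
proof -
  have sub: "subgroup H G" and fin: "finite ((\<lambda>a. H #> a) ` carrier G)"
    using assms by (auto simp: finite_index_def RCOSETS_def UNION_singleton_eq_range)
  \<comment> \<open>The coset map has finite image, so finitely many representatives in
    \<open>T\<close> already meet every right coset.\<close>
  obtain T where T: "T \<subseteq> carrier G" "finite T"
      "(\<lambda>a. H #> a) ` carrier G = (\<lambda>a. H #> a) ` T"
    using finite_subset_image[OF fin, of "\<lambda>a. H #> a" "carrier G"] by auto
  have "\<exists>h\<in>H. \<exists>t\<in>T. x = h \<otimes> t" if x: "x \<in> carrier G" for x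
  proof -
    obtain t where t: "t \<in> T" "H #> x = H #> t"
      using x T(3) by (metis (no_types, lifting) imageE imageI)
    have "x \<in> H #> t"
      using rcos_self[OF x sub] t by simp
    then show ?thesis
      using t by (auto simp: r_coset_def)
  qed
  with T that show ?thesis by blast
qed

lemma finite_if_finite_index:
  assumes "finite_index G H" "finite H"
  shows "finite (carrier G)"
proof -
  obtain T where T: "finite T" "\<And>x. x \<in> carrier G \<Longrightarrow> \<exists>h\<in>H. \<exists>t\<in>T. x = h \<otimes> t"
    using finite_index_transversal[OF assms(1)] by metis
  have "carrier G \<subseteq> (\<lambda>(h, t). h \<otimes> t) ` (H \<times> T)"
    using T(2) by fastforce
  then show ?thesis
    using assms(2) T(1) by (meson finite_SigmaI finite_imageI finite_subset)
qed

text \<open>For \<open>x = h \<otimes> t\<close>, conjugating by \<open>x\<close> means conjugating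
  by \<open>h\<close> and then by \<open>t\<close>. With \<open>t\<close> from a finite transversal,
  finitely many \<open>H\<close>-conjugates yield only finitely many
  \<open>G\<close>-conjugates.\<close>

lemma FC_if_finite_subgroup_conjugates:
  assumes fi: "finite_index G H" and g: "g \<in> carrier G"
    and fin: "finite {inv h \<otimes> g \<otimes> h | h. h \<in> H}"
  shows "g \<in> FC G"
proof -
  obtain T where T: "finite T" "T \<subseteq> carrier G"
      "\<And>x. x \<in> carrier G \<Longrightarrow> \<exists>h\<in>H. \<exists>t\<in>T. x = h \<otimes> t"
    using finite_index_transversal[OF fi] by metis
  have H: "H \<subseteq> carrier G"
    using fi by (auto simp: finite_index_def dest: subgroup.subset)
  let ?C = "{inv h \<otimes> g \<otimes> h | h. h \<in> H}"
  have "inv x \<otimes> g \<otimes> x \<in> (\<lambda>(t, c). inv t \<otimes> c \<otimes> t) ` (T \<times> ?C)" if x: "x \<in> carrier G" for x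
  proof -
    obtain h t where ht: "h \<in> H" "t \<in> T" "x = h \<otimes> t"
      using T(3)[OF x] by blast
    have "inv x \<otimes> g \<otimes> x = inv t \<otimes> (inv h \<otimes> g \<otimes> h) \<otimes> t"
      using ht H T(2) g by (simp add: subset_iff inv_mult_group m_assoc)
    then show ?thesis using ht by force
  qed
  then have "{inv x \<otimes> g \<otimes> x | x. x \<in> carrier G} \<subseteq> (\<lambda>(t, c). inv t \<otimes> c \<otimes> t) ` (T \<times> ?C)"
    by blast
  then have "finite {inv x \<otimes> g \<otimes> x | x. x \<in> carrier G}"
    using T(1) fin by (meson finite_SigmaI finite_imageI finite_subset)
  then show ?thesis using g by (simp add: FC_def)
qed

text \<open>A conjugate of \<open>g\<close> differs from \<open>g\<close> by a commutator, so the
  \<open>H\<close>-conjugates of \<open>g\<close> lie in a translate of the finite set of inverses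
  of \<open>FC G\<close>.\<close>

lemma FC_if_commutators_FC:
  assumes fi: "finite_index G H" and fin: "finite (FC G)" and g: "g \<in> carrier G"
    and comm: "\<And>h. h \<in> H \<Longrightarrow> g \<otimes> h \<otimes> inv g \<otimes> inv h \<in> FC G"
  shows "g \<in> FC G"
proof (rule FC_if_finite_subgroup_conjugates[OF fi g])
  have sub: "subgroup H G" using fi by (simp add: finite_index_def)
  have "inv h \<otimes> g \<otimes> h \<in> (\<lambda>f. inv f \<otimes> g) ` FC G" if h: "h \<in> H" for h
  proof -
    \<comment> \<open>The commutator is taken with \<open>inv h\<close>, so that
      \<open>inv ?f \<otimes> g\<close> is the conjugate by \<open>h\<close> in the convention of
      \<open>FC\<close>.\<close>
    let ?f = "g \<otimes> inv h \<otimes> inv g \<otimes> inv (inv h)"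
    have hc: "h \<in> carrier G" using subgroup.mem_carrier[OF sub h] .
    have "?f \<in> FC G" using comm[OF subgroup.m_inv_closed[OF sub h]] .
    moreover have "inv h \<otimes> g \<otimes> h = inv ?f \<otimes> g"
      using hc g by (simp add: inv_mult_group m_assoc)
    ultimately show ?thesis by blast
  qed
  then have "{inv h \<otimes> g \<otimes> h | h. h \<in> H} \<subseteq> (\<lambda>f. inv f \<otimes> g) ` FC G" by blast
  then show "finite {inv h \<otimes> g \<otimes> h | h. h \<in> H}"
    using fin by (meson finite_imageI finite_subset)
qed

text \<open>Each induction step passes from term \<open>Suc k\<close> up to the larger term
  \<open>k\<close>, whose commutators with \<open>H\<close> are generators of term
  \<open>Suc k\<close>; term 0 is \<open>H\<close> itself. Intersecting with \<open>H\<close>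
  supplies membership in \<open>H\<close> without a separate proof that the series stays inside
  it.\<close>

lemma subgroup_subset_FC:
  assumes fi: "finite_index G H" and fin: "finite (FC G)"
    and "H \<inter> lower_central (G\<lparr>carrier := H\<rparr>) k \<subseteq> FC G"
  shows "H \<subseteq> FC G"
  using assms(3)
proof (induction k)
  case 0
  then show ?case by simp
next
  case (Suc k)
  have sub: "subgroup H G" using fi by (simp add: finite_index_def)
  have "g \<in> FC G" if g: "g \<in> H" "g \<in> lower_central (G\<lparr>carrier := H\<rparr>) k" for g
  proof (rule FC_if_commutators_FC[OF fi fin subgroup.mem_carrier[OF sub g(1)]])
    fix h assume h: "h \<in> H"
    have "g \<otimes> h \<otimes> inv g \<otimes> inv h \<in> H"
      using sub g(1) h by (simp add: subgroup.m_closed subgroup.m_inv_closed)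
    moreover have "g \<otimes> h \<otimes> inv g \<otimes> inv h \<in> lower_central (G\<lparr>carrier := H\<rparr>) (Suc k)"
      \<comment> \<open>The series is built with the inverse of the restricted structure, which
        agrees on \<open>H\<close> with that of \<open>G\<close>.\<close>
      unfolding lower_central.simps using g h m_inv_consistent[OF sub]
      by (intro generate.incl CollectI exI[of _ g] exI[of _ h]) simp
    ultimately show "g \<otimes> h \<otimes> inv g \<otimes> inv h \<in> FC G" using Suc.prems by blast
  qed
  then show ?case using Suc.IH by blast
qed

lemma one_in_FC: "\<one> \<in> FC G"
proof -
  have "{inv x \<otimes> \<one> \<otimes> x | x. x \<in> carrier G} \<subseteq> {\<one>}" by auto
  then show ?thesis unfolding FC_def using finite_subset by auto
qed

theorem infinite_FC:
  assumes "infinite (carrier G)" "finite_index G H" "nilpotent_group (G\<lparr>carrier := H\<rparr>)"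
  shows "infinite (FC G)"
proof
  assume fin: "finite (FC G)"
  obtain c where "lower_central (G\<lparr>carrier := H\<rparr>) c = {\<one>}"
    using assms(3) by (auto simp: nilpotent_group_def)
  then have "H \<subseteq> FC G"
    using one_in_FC by (intro subgroup_subset_FC[OF assms(2) fin, of c]) auto
  then have "finite H" using fin finite_subset by blast
  with finite_if_finite_index[OF assms(2)] assms(1) show False by blast
qed

end

text \<open>An ultrafilter containing a singleton is principal. So the complement of each point is
  in \<open>\<omega>\<close>, and with it every finite intersection of such complements, that is,
  every cofinite set.\<close>

lemma nonprincipal_ultrafilter_le_cofinite:
  assumes "nonprincipal_ultrafilter \<omega>"
  shows "\<omega> \<le> cofinite"
proof -
  have ne: "\<omega> \<noteq> bot" and ultra: "\<And>P. eventually P \<omega> \<or> eventually (\<lambda>n. \<not> P n) \<omega>"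
    and np: "\<And>n. \<omega> \<noteq> principal {n}"
    using assms by (auto simp: nonprincipal_ultrafilter_def ultrafilter_def)
  have neq: "eventually (\<lambda>m. m \<noteq> n) \<omega>" for n
  proof (rule ccontr)
    assume "\<not> eventually (\<lambda>m. m \<noteq> n) \<omega>"
    then have eq: "eventually (\<lambda>m. m = n) \<omega>" using ultra[of "\<lambda>m. m = n"] by blast
    have "eventually P \<omega> \<longleftrightarrow> P n" for P
    proof
      assume "eventually P \<omega>"
      \<comment> \<open>On the set where \<open>m = n\<close>, the predicate is the constant
        \<open>P n\<close>, and a constant holding eventually along a proper filter is true.\<close>
      then have "eventually (\<lambda>_. P n) \<omega>"
        using eq by eventually_elim simp
      then show "P n" using ne by (simp add: eventually_const_iff)
    next
      assume "P n"
      then show "eventually P \<omega>" using eq by (auto elim: eventually_mono)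
    qed
    then have "\<omega> = principal {n}" by (simp add: filter_eq_iff eventually_principal)
    then show False using np by blast
  qed
  show ?thesis
  proof (rule filter_leI)
    fix P :: "'a \<Rightarrow> bool" assume "eventually P cofinite"
    then have "finite {n. \<not> P n}" by (simp add: eventually_cofinite)
    then have "eventually (\<lambda>m. \<forall>n\<in>{n. \<not> P n}. m \<noteq> n) \<omega>"
      using neq by (intro eventually_ball_finite) auto
    then show "eventually P \<omega>" by (rule eventually_mono) blast
  qed
qed

text \<open>By monotonicity, a single value above \<open>Z\<close> keeps all later ones above
  it.\<close>

lemma incseq_unbounded_at_top:
  fixes d :: "nat \<Rightarrow> real"
  assumes "incseq d" "\<not> bdd_above (range d)"
  shows "filterlim d at_top sequentially"
  unfolding filterlim_at_top
proof
  fix Z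
  obtain N where "Z < d N"
    using assms(2) by (metis bdd_above.I2 not_le)
  then have "Z \<le> d n" if "n \<ge> N" for n
    using incseqD[OF assms(1) that] by simp
  then show "eventually (\<lambda>n. Z \<le> d n) sequentially"
    by (auto simp: eventually_sequentially)
qed

context cone_setup
begin

lemma FC_subset_cone_kernel:
  assumes lim: "filterlim d at_top \<omega>"
  shows "FC G \<subseteq> cone_kernel G S \<omega> d"
proof
  fix g assume g: "g \<in> FC G"
  let ?C = "{inv x \<otimes> g \<otimes> x | x. x \<in> carrier G}"
  have "finite (word_length G S ` ?C)" using g by (auto simp: FC_def)
  \<comment> \<open>\<open>M\<close> depends only on \<open>g\<close>, so one bound serves every
    index and every admissible sequence.\<close>
  then obtain M where "\<forall>k \<in> word_length G S ` ?C. k \<le> M"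
    unfolding finite_nat_set_iff_bounded_le by (rule exE)
  then have M: "word_length G S c \<le> M" if "c \<in> ?C" for c
    using that by (rule bspec[OF _ imageI])
  have "((\<lambda>n. real (word_length G S (inv (x n) \<otimes> g \<otimes> x n)) / d n) \<longlongrightarrow> 0) \<omega>"
    if x: "x \<in> admissible G S d" for x
  proof (rule tendsto_sandwich[OF _ _ tendsto_const])
    show "((\<lambda>n. real M / d n) \<longlongrightarrow> 0) \<omega>"
      by (rule real_tendsto_divide_at_top[OF tendsto_const lim])
    show "\<forall>\<^sub>F n in \<omega>. real (word_length G S (inv (x n) \<otimes> g \<otimes> x n)) / d n \<le> real M / d n"
      using M admissible_closed[OF x] less_imp_le[OF pos]
      by (intro always_eventually allI divide_right_mono) auto
    show "\<forall>\<^sub>F n in \<omega>. 0 \<le> real (word_length G S (inv (x n) \<otimes> g \<otimes> x n)) / d n"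
      using less_imp_le[OF pos] by (intro always_eventually allI divide_nonneg_nonneg) auto
  qed
  then show "g \<in> cone_kernel G S \<omega> d"
    using g by (auto simp: cone_kernel_eq FC_def)
qed

end

theorem proposition7p2:
  fixes G :: "('a, 'b) monoid_scheme" (structure)
  assumes "group G"
    and "infinite (carrier G)"
    and "\<exists>S. finite_generating_set G S"
    and "\<exists>H. finite_index G H \<and> nilpotent_group (G\<lparr>carrier := H\<rparr>)"
  shows "infinite (FC G) \<and>
    (\<forall>S \<omega> d. finite_generating_set G S \<longrightarrow> nonprincipal_ultrafilter \<omega> \<longrightarrow>
       (\<forall>n. 0 < d n) \<longrightarrow> incseq d \<longrightarrow> \<not> bdd_above (range d) \<longrightarrow>
       infinite (cone_kernel G S \<omega> d))"
proof (intro conjI allI impI)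
  show FC: "infinite (FC G)"
    using assms(2,4) group.infinite_FC[OF assms(1)] by blast
  fix S :: "'a set" and \<omega> :: "nat filter" and d :: "nat \<Rightarrow> real"
  assume S: "finite_generating_set G S" and \<omega>: "nonprincipal_ultrafilter \<omega>"
    and d: "\<forall>n. 0 < d n" "incseq d" "\<not> bdd_above (range d)"
  interpret group G by fact
  interpret cone_setup G S \<omega> d
    by unfold_locales (use S d in auto)
  \<comment> \<open>On the naturals the cofinite filter is \<open>sequentially\<close>, so
    \<open>\<omega>\<close> refines it and inherits the divergence of \<open>d\<close>.\<close>
  have "filterlim d at_top \<omega>"
    using filterlim_mono[OF incseq_unbounded_at_top[OF d(2,3)] order_refl]
      nonprincipal_ultrafilter_le_cofinite[OF \<omega>] by (simp add: cofinite_eq_sequentially)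
  from FC_subset_cone_kernel[OF this] FC show "infinite (cone_kernel G S \<omega> d)"
    using finite_subset by blast
qed

end
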